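(* There exist infinitely many families $\mathcal{F}$ of graphs with $|\mathcal{F}| = 3$ such that the ratio $\frac{\mathrm{sat}(n,\mathcal{F})}{n}$ does not converge as $n \to \infty$.
   Context: For a family of graphs $\mathcal{F}$, a graph $G$ is $\mathcal{F}$-saturated if $G$ contains no copy (subgraph isomorphic to) of any graph in $\mathcal{F}$, but adding any edge to $G$ creates a copy of some graph in $\mathcal{F}$. $\mathrm{sat}(n,\mathcal{F})$ is the minimum number of edges in an $n$-vertex $\mathcal{F}$-saturated graph. *)

theory Defs
  imports Complex_Main
begin

text \<open>
  Finite simple graphs, given as a vertex set and a set of two-element edges. Taking vertices
  in \<^typ>\<open>nat\<close> loses nothing, as every finite graph is isomorphic to such a graph.
\<close>

type_synonym graph = "nat set \<times> nat set set"

abbreviation verts :: "graph \<Rightarrow> nat set" where "verts G \<equiv> fst G"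
abbreviation edges :: "graph \<Rightarrow> nat set set" where "edges G \<equiv> snd G"

definition vertex_pairs :: "nat set \<Rightarrow> nat set set" where
  "vertex_pairs V = {e. e \<subseteq> V \<and> card e = 2}"

definition fin_graphs :: "graph set" where
  "fin_graphs = {G. finite (verts G) \<and> edges G \<subseteq> vertex_pairs (verts G)}"

definition subgraph :: "graph \<Rightarrow> graph \<Rightarrow> bool" where
  "subgraph H G \<longleftrightarrow> H \<in> fin_graphs \<and> G \<in> fin_graphs \<and>
     verts H \<subseteq> verts G \<and> edges H \<subseteq> edges G"

definition graph_iso :: "(graph \<times> graph) set" where
  "graph_iso = {(G, H). G \<in> fin_graphs \<and> H \<in> fin_graphs \<and>
     (\<exists>f. bij_betw f (verts G) (verts H) \<and> (\<lambda>e. f ` e) ` edges G = edges H)}"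

text \<open>
  As usual, the graphs in a family are considered up to isomorphism: a family is a set of
  isomorphism classes. Otherwise relabelling a single family would already produce infinitely
  many families, and three copies of one graph would form a family of size three.
\<close>

definition iso_classes :: "graph set set" where
  "iso_classes = fin_graphs // graph_iso"

definition contains_copy :: "graph \<Rightarrow> graph \<Rightarrow> bool" where
  "contains_copy G H \<longleftrightarrow> (\<exists>H'. subgraph H' G \<and> (H, H') \<in> graph_iso)"

definition contains_member :: "graph \<Rightarrow> graph set set \<Rightarrow> bool" where
  "contains_member G \<F> \<longleftrightarrow> (\<exists>C\<in>\<F>. \<exists>H\<in>C. contains_copy G H)"

definition add_edge :: "nat set \<Rightarrow> graph \<Rightarrow> graph" where
  "add_edge e G = (verts G, insert e (edges G))"

definition saturated :: "graph set set \<Rightarrow> graph \<Rightarrow> bool" where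
  "saturated \<F> G \<longleftrightarrow> G \<in> fin_graphs \<and> \<not> contains_member G \<F> \<and>
     (\<forall>e \<in> vertex_pairs (verts G) - edges G. contains_member (add_edge e G) \<F>)"

text \<open>
  If no member of the family is edgeless, a saturated graph exists for every \<^term>\<open>n\<close>.
  If some member is edgeless, there is none for large \<^term>\<open>n\<close>, and
  the infimum is then a fixed number (the value at the empty set), so that
  \<open>sat n \<F> / n\<close> tends to \<open>0\<close>; this convention therefore creates no divergent family.
\<close>

definition sat :: "nat \<Rightarrow> graph set set \<Rightarrow> nat" where
  "sat n \<F> = Inf {card (edges G) | G. saturated \<F> G \<and> card (verts G) = n}"

lemma equiv_graph_iso: "equiv fin_graphs graph_iso"
proof (rule equivI)
  show "graph_iso \<subseteq> fin_graphs \<times> fin_graphs"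
    by (auto simp: graph_iso_def)
  show "refl_on fin_graphs graph_iso"
    by (auto simp: refl_on_def graph_iso_def intro!: exI[of _ id])
  show "sym graph_iso"
  proof (rule symI)
    fix G H assume "(G, H) \<in> graph_iso"
    then obtain f where G: "G \<in> fin_graphs" and H: "H \<in> fin_graphs"
      and f: "bij_betw f (verts G) (verts H)" and E: "(\<lambda>e. f ` e) ` edges G = edges H"
      by (auto simp: graph_iso_def)
    let ?g = "inv_into (verts G) f"
    have "?g ` f ` e = e" if "e \<in> edges G" for e
    proof -
      have "e \<subseteq> verts G" using that G by (auto simp: fin_graphs_def vertex_pairs_def)
      then show ?thesis using f by (simp add: bij_betw_def inv_into_image_cancel)
    qed
    then have "(\<lambda>e. ?g ` e) ` edges H = edges G"
      unfolding E[symmetric] image_image by (simp add: image_def)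
    with G H bij_betw_inv_into[OF f] show "(H, G) \<in> graph_iso"
      by (auto simp: graph_iso_def simp del: prod.collapse)
  qed
  show "trans graph_iso"
  proof (rule transI)
    fix G H K assume "(G, H) \<in> graph_iso" "(H, K) \<in> graph_iso"
    then obtain f g where G: "G \<in> fin_graphs" and K: "K \<in> fin_graphs"
      and f: "bij_betw f (verts G) (verts H)" "(\<lambda>e. f ` e) ` edges G = edges H"
      and g: "bij_betw g (verts H) (verts K)" "(\<lambda>e. g ` e) ` edges H = edges K"
      by (auto simp: graph_iso_def)
    have "(\<lambda>e. (g \<circ> f) ` e) ` edges G = edges K"
      unfolding g(2)[symmetric] f(2)[symmetric] by (simp add: image_comp comp_def image_image)
    with G K bij_betw_trans[OF f(1) g(1)] show "(G, K) \<in> graph_iso"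
      unfolding graph_iso_def by blast
  qed
qed

end

theory Submission imports Defs begin

text \<open>
  For \<open>m \<ge> 4\<close> forbid three graphs: \<open>K\<^sub>m\<close> with an extra vertex joined to two of its vertices,
  two copies of \<open>K\<^sub>m\<close> sharing exactly one vertex, and two disjoint copies of \<open>K\<^sub>m\<close> joined by an
  edge. A graph avoiding them has pairwise disjoint \<open>m\<close>-cliques without edges in between.

  If \<open>m\<close> divides \<open>n\<close>, a disjoint union of copies of \<open>K\<^sub>m\<close> is saturated and has \<open>(m - 1) n / 2\<close>
  edges. Otherwise some vertex \<open>r\<close> of a saturated graph lies in no \<open>m\<close>-clique. Joining \<open>r\<close> to a
  vertex \<open>v\<close> whose clique (if any) contains no neighbour of \<open>r\<close> must create a \<open>K\<^sub>m\<close>, so \<open>v\<close> has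
  \<open>m - 2\<close> neighbours inside the neighbourhood of \<open>r\<close>. If some such \<open>r\<close> has degree at most
  \<open>\<epsilon> n\<close>, this gives about \<open>(m - 2) n\<close> edges, which exceeds \<open>(m - 1) n / 2\<close> by a linear term
  since \<open>m \<ge> 4\<close>. If all such \<open>r\<close> have degree above \<open>\<epsilon> n\<close>, then a single one already raises the
  degree sum linearly above \<open>(m - 1) n\<close>, as all other vertices have degree at least \<open>m - 1\<close>.
\<close>

section \<open>Copies of graphs\<close>

lemma vertex_pairs_mono: "A \<subseteq> B \<Longrightarrow> vertex_pairs A \<subseteq> vertex_pairs B"
  by (auto simp: vertex_pairs_def)

lemma pair_in_vertex_pairs [simp]: "{u, v} \<in> vertex_pairs V \<longleftrightarrow> u \<in> V \<and> v \<in> V \<and> u \<noteq> v"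
  by (auto simp: vertex_pairs_def card_2_iff doubleton_eq_iff)

lemma vertex_pairsE:
  assumes "e \<in> vertex_pairs V"
  obtains u v where "e = {u, v}" "u \<in> V" "v \<in> V" "u \<noteq> v"
  using assms by (auto simp: vertex_pairs_def card_2_iff)

lemma edges_doubletonD:
  assumes "G \<in> fin_graphs" "{u, v} \<in> edges G"
  shows "u \<in> verts G" "v \<in> verts G" "u \<noteq> v"
proof -
  have "{u, v} \<in> vertex_pairs (verts G)" using assms unfolding fin_graphs_def by blast
  then show "u \<in> verts G" "v \<in> verts G" "u \<noteq> v" by simp_all
qed

lemma finite_edges:
  assumes "G \<in> fin_graphs"
  shows "finite (edges G)"
proof (rule finite_subset)
  show "edges G \<subseteq> Pow (verts G)" using assms by (auto simp: fin_graphs_def vertex_pairs_def)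
  show "finite (Pow (verts G))" using assms by (simp add: fin_graphs_def)
qed

text \<open>Copies become injective edge-preserving maps, which are easier to build and to restrict.
  The image of \<open>H\<close> under such a map is itself a graph, and this image is the
  copy.\<close>

lemma contains_copy_iff:
  assumes G: "G \<in> fin_graphs" and H: "H \<in> fin_graphs"
  shows "contains_copy G H \<longleftrightarrow>
    (\<exists>f. inj_on f (verts H) \<and> f ` verts H \<subseteq> verts G \<and> (\<forall>e\<in>edges H. f ` e \<in> edges G))"
proof
  assume "contains_copy G H"
  then obtain H' where H': "subgraph H' G" "(H, H') \<in> graph_iso"
    unfolding contains_copy_def by blast
  then obtain f where f: "bij_betw f (verts H) (verts H')" "(\<lambda>e. f ` e) ` edges H = edges H'"
    by (auto simp: graph_iso_def)
  have "f ` verts H \<subseteq> verts G" "(\<lambda>e. f ` e) ` edges H \<subseteq> edges G"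
    using H'(1) unfolding bij_betw_imp_surj_on[OF f(1)] f(2) subgraph_def by simp_all
  then show "\<exists>f. inj_on f (verts H) \<and> f ` verts H \<subseteq> verts G \<and> (\<forall>e\<in>edges H. f ` e \<in> edges G)"
    using bij_betw_imp_inj_on[OF f(1)] by (intro exI[of _ f]) (simp add: image_subset_iff)
next
  assume "\<exists>f. inj_on f (verts H) \<and> f ` verts H \<subseteq> verts G \<and> (\<forall>e\<in>edges H. f ` e \<in> edges G)"
  then obtain f where f: "inj_on f (verts H)" "f ` verts H \<subseteq> verts G"
    "\<forall>e\<in>edges H. f ` e \<in> edges G" by (elim exE conjE)
  let ?H = "(f ` verts H, (\<lambda>e. f ` e) ` edges H)"
  have "f ` e \<in> vertex_pairs (f ` verts H)" if "e \<in> edges H" for e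
  proof -
    have e: "e \<subseteq> verts H" "card e = 2" using that H by (auto simp: fin_graphs_def vertex_pairs_def)
    then have "card (f ` e) = 2" using card_image[OF inj_on_subset[OF f(1) e(1)]] by simp
    then show ?thesis using e(1) by (simp add: vertex_pairs_def image_mono)
  qed
  then have H': "?H \<in> fin_graphs" using H by (simp add: fin_graphs_def image_subset_iff)
  then have "subgraph ?H G" using G f(2,3) by (simp add: subgraph_def image_subset_iff)
  moreover have "(H, ?H) \<in> graph_iso"
    using H H' inj_on_imp_bij_betw[OF f(1)] by (auto simp: graph_iso_def simp del: prod.collapse)
  ultimately show "contains_copy G H" unfolding contains_copy_def by blast
qed

lemma contains_copy_iso:
  assumes "(H, H') \<in> graph_iso" "contains_copy G H'"
  shows "contains_copy G H"
  using assms equiv_graph_iso unfolding contains_copy_def equiv_def by (meson transD)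

text \<open>Copies transfer along isomorphisms, so one representative decides for its whole class;
  reflexivity puts the representative in that class.\<close>

lemma contains_member_iso_classes:
  assumes "S \<subseteq> fin_graphs"
  shows "contains_member G ((\<lambda>H. graph_iso `` {H}) ` S) \<longleftrightarrow> (\<exists>H\<in>S. contains_copy G H)"
proof
  assume "contains_member G ((\<lambda>H. graph_iso `` {H}) ` S)"
  then show "\<exists>H\<in>S. contains_copy G H"
    unfolding contains_member_def by (auto intro: contains_copy_iso)
next
  assume "\<exists>H\<in>S. contains_copy G H"
  then obtain H where H: "H \<in> S" "contains_copy G H" by blast
  then have "(H, H) \<in> graph_iso"
    using assms equiv_graph_iso by (auto simp: equiv_def refl_on_def simp del: prod.collapse)
  with H show "contains_member G ((\<lambda>H. graph_iso `` {H}) ` S)"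
    unfolding contains_member_def by blast
qed

text \<open>The vertex count is the only invariant used to tell isomorphism classes apart.
  Reflexivity at \<open>H\<close> places \<open>H\<close> in the class of \<open>H'\<close>.\<close>

lemma iso_class_eq_card_verts:
  assumes "H \<in> fin_graphs" "graph_iso `` {H} = graph_iso `` {H'}"
  shows "card (verts H) = card (verts H')"
proof -
  have "(H', H) \<in> graph_iso"
    using assms equiv_graph_iso by (auto simp: equiv_def refl_on_def simp del: prod.collapse)
  then show ?thesis by (auto simp: graph_iso_def dest!: bij_betw_same_card)
qed

text \<open>The complements of \<open>S\<close> and of its image have equal size, so a bijection
  between them completes \<open>p\<close>. This serves to label a clique with a few vertices
  prescribed.\<close>

lemma ex_bij_betw_extending:
  assumes "finite A" "finite B" "card A = card B" "S \<subseteq> A" "p ` S \<subseteq> B" "inj_on p S"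
  obtains f where "bij_betw f A B" "\<And>x. x \<in> S \<Longrightarrow> f x = p x"
proof -
  have "card (A - S) = card (B - p ` S)"
    using assms by (simp add: card_Diff_subset card_image finite_subset[of _ A])
  then obtain h where h: "bij_betw h (A - S) (B - p ` S)"
    using finite_same_card_bij[of "A - S" "B - p ` S"] assms by blast
  let ?f = "\<lambda>x. if x \<in> S then p x else h x"
  have "bij_betw ?f S (p ` S)" using assms by (auto simp: bij_betw_def inj_on_def)
  moreover have "bij_betw ?f (A - S) (B - p ` S)"
    using h by (rule bij_betw_cong[THEN iffD1, rotated]) auto
  ultimately have "bij_betw ?f (S \<union> (A - S)) (p ` S \<union> (B - p ` S))"
    by (rule bij_betw_combine) auto
  moreover have "S \<union> (A - S) = A" "p ` S \<union> (B - p ` S) = B" using assms by auto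
  ultimately have "bij_betw ?f A B" by simp
  then show thesis by (rule that) auto
qed

section \<open>The forbidden families\<close>

definition clique :: "nat \<Rightarrow> graph \<Rightarrow> nat set \<Rightarrow> bool" where
  "clique m G K \<longleftrightarrow> K \<subseteq> verts G \<and> card K = m \<and> vertex_pairs K \<subseteq> edges G"

definition clique_ear :: "nat \<Rightarrow> graph" where
  "clique_ear m = ({..m}, vertex_pairs {..<m} \<union> {{0, m}, {1, m}})"

text \<open>The second clique reuses vertex \<open>0\<close> and takes \<open>m - 1\<close> fresh
  vertices, hence the bound \<open>2 * m - 1\<close>.\<close>

definition clique_bowtie :: "nat \<Rightarrow> graph" where
  "clique_bowtie m = ({..<2 * m - 1}, vertex_pairs {..<m} \<union> vertex_pairs (insert 0 {m..<2 * m - 1}))"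

definition clique_dumbbell :: "nat \<Rightarrow> graph" where
  "clique_dumbbell m = ({..<2 * m}, vertex_pairs {..<m} \<union> vertex_pairs {m..<2 * m} \<union> {{0, m}})"

definition forbidden_family :: "nat \<Rightarrow> graph set set" where
  "forbidden_family m = (\<lambda>H. graph_iso `` {H}) ` {clique_ear m, clique_bowtie m, clique_dumbbell m}"

text \<open>The three predicates \<open>has_ear\<close>, \<open>has_bowtie\<close> and
  \<open>has_dumbbell\<close> describe the forbidden copies through cliques of the host graph, so
  that later arguments handle no embeddings.\<close>

definition has_ear :: "nat \<Rightarrow> graph \<Rightarrow> bool" where
  "has_ear m G \<longleftrightarrow> (\<exists>K x a b. clique m G K \<and> x \<notin> K \<and> a \<in> K \<and> b \<in> K \<and> a \<noteq> b \<and>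
     {a, x} \<in> edges G \<and> {b, x} \<in> edges G)"

definition has_bowtie :: "nat \<Rightarrow> graph \<Rightarrow> bool" where
  "has_bowtie m G \<longleftrightarrow> (\<exists>K L. clique m G K \<and> clique m G L \<and> card (K \<inter> L) = 1)"

definition has_dumbbell :: "nat \<Rightarrow> graph \<Rightarrow> bool" where
  "has_dumbbell m G \<longleftrightarrow> (\<exists>K L a b. clique m G K \<and> clique m G L \<and> K \<inter> L = {} \<and>
     a \<in> K \<and> b \<in> L \<and> {a, b} \<in> edges G)"

definition forbidden :: "nat \<Rightarrow> graph \<Rightarrow> bool" where
  "forbidden m G \<longleftrightarrow> has_ear m G \<or> has_bowtie m G \<or> has_dumbbell m G"

section \<open>Forbidden graphs as clique configurations\<close>

lemma cliqueD:
  assumes "clique m G K"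
  shows "K \<subseteq> verts G" "card K = m" "\<And>u v. u \<in> K \<Longrightarrow> v \<in> K \<Longrightarrow> u \<noteq> v \<Longrightarrow> {u, v} \<in> edges G"
  using assms by (auto simp: clique_def)

lemma clique_finite: "G \<in> fin_graphs \<Longrightarrow> clique m G K \<Longrightarrow> finite K"
  by (auto simp: fin_graphs_def dest: cliqueD(1) finite_subset)

lemma clique_image:
  assumes "inj_on f A" "f ` A \<subseteq> verts G" "\<And>e. e \<in> vertex_pairs A \<Longrightarrow> f ` e \<in> edges G"
  shows "clique (card A) G (f ` A)"
proof -
  have "e \<in> edges G" if e: "e \<in> vertex_pairs (f ` A)" for e
  proof -
    obtain x y where "e = {x, y}" "x \<in> f ` A" "y \<in> f ` A" "x \<noteq> y"
      using e by (rule vertex_pairsE)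
    then obtain u v where "e = {f u, f v}" "u \<in> A" "v \<in> A" "f u \<noteq> f v" by blast
    then show ?thesis using assms(3)[of "{u, v}"] by auto
  qed
  then show ?thesis using assms by (auto simp: clique_def card_image)
qed

lemma clique_bij_betw_edges:
  assumes "clique m G K" "bij_betw f A K" "e \<in> vertex_pairs A"
  shows "f ` e \<in> edges G"
proof -
  obtain u v where uv: "e = {u, v}" "u \<in> A" "v \<in> A" "u \<noteq> v" using assms(3) by (rule vertex_pairsE)
  then have "f u \<in> K" "f v \<in> K" "f u \<noteq> f v" using assms(2) by (auto simp: bij_betw_def inj_on_def)
  then show ?thesis using uv cliqueD(3)[OF assms(1)] by simp
qed

lemma forbidden_graphs_fin:
  assumes "m \<ge> 2"
  shows "clique_ear m \<in> fin_graphs" "clique_bowtie m \<in> fin_graphs" "clique_dumbbell m \<in> fin_graphs"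
proof -
  have "vertex_pairs {..<m} \<subseteq> vertex_pairs {..m}" by (intro vertex_pairs_mono) auto
  then show "clique_ear m \<in> fin_graphs" using assms by (auto simp: clique_ear_def fin_graphs_def)
  have "vertex_pairs {..<m} \<subseteq> vertex_pairs {..<2 * m - 1}"
    "vertex_pairs (insert 0 {m..<2 * m - 1}) \<subseteq> vertex_pairs {..<2 * m - 1}"
    using assms by (auto intro!: vertex_pairs_mono)
  then show "clique_bowtie m \<in> fin_graphs" by (simp add: clique_bowtie_def fin_graphs_def)
  have "vertex_pairs {..<m} \<subseteq> vertex_pairs {..<2 * m}"
    "vertex_pairs {m..<2 * m} \<subseteq> vertex_pairs {..<2 * m}"
    by (auto intro!: vertex_pairs_mono)
  then show "clique_dumbbell m \<in> fin_graphs"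
    using assms by (simp add: clique_dumbbell_def fin_graphs_def)
qed

lemma contains_clique_ear_iff:
  assumes G: "G \<in> fin_graphs" and m: "m \<ge> 2"
  shows "contains_copy G (clique_ear m) \<longleftrightarrow> has_ear m G"
proof
  assume "contains_copy G (clique_ear m)"
  then obtain f where f: "inj_on f {..m}" "f ` {..m} \<subseteq> verts G"
    and e': "\<forall>e\<in>vertex_pairs {..<m} \<union> {{0, m}, {1, m}}. f ` e \<in> edges G"
    unfolding contains_copy_iff[OF G forbidden_graphs_fin(1)[OF m]]
      unfolding clique_ear_def fst_conv snd_conv by (elim exE conjE) (rule that)
  note e = bspec[OF e']
  have "clique (card {..<m}) G (f ` {..<m})"
    using f e by (intro clique_image) (auto intro: inj_on_subset)
  moreover have "f m \<notin> f ` {..<m}" using f(1) by (force simp: inj_on_def)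
  moreover have "f 0 \<noteq> f 1" using inj_onD[OF f(1), of 0 1] m by auto
  moreover have "{f 0, f m} \<in> edges G" "{f 1, f m} \<in> edges G"
    using e[of "{0, m}"] e[of "{1, m}"] by simp_all
  ultimately show "has_ear m G" unfolding has_ear_def
    using m by (intro exI[of _ "f ` {..<m}"] exI[of _ "f m"] exI[of _ "f 0"] exI[of _ "f 1"]) auto
next
  assume "has_ear m G"
  then obtain K x a b where K: "clique m G K" "x \<notin> K" "a \<in> K" "b \<in> K" "a \<noteq> b"
    "{a, x} \<in> edges G" "{b, x} \<in> edges G" unfolding has_ear_def by blast
  obtain f where f: "bij_betw f {..<m} K"
    and fp: "\<And>y. y \<in> {0, 1} \<Longrightarrow> f y = (if y = (0::nat) then a else b)"
    by (rule ex_bij_betw_extending[of "{..<m}" K "{0, 1}" "\<lambda>y. if y = 0 then a else b"])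
      (use K m clique_finite[OF G K(1)] cliqueD(2)[OF K(1)] in \<open>auto simp: inj_on_def\<close>)
  \<comment> \<open>The labels below \<open>m\<close> enumerate the clique with \<open>0\<close> and
    \<open>1\<close> at the feet \<open>a\<close> and \<open>b\<close> of the ear; the label
    \<open>m\<close> is free for the ear vertex.\<close>
  let ?g = "f(m := x)"
  have g: "bij_betw ?g {..<m} K" using f by (rule bij_betw_cong[THEN iffD1, rotated]) auto
  have eq: "{..m} = insert m {..<m}" by auto
  have "inj_on ?g {..m}" using g K(2) unfolding eq by (auto simp: bij_betw_def inj_on_def)
  moreover have "?g ` {..m} \<subseteq> verts G"
    using g cliqueD(1)[OF K(1)] edges_doubletonD[OF G K(6)] unfolding eq by (auto simp: bij_betw_def)
  moreover have "?g ` e \<in> edges G" if "e \<in> vertex_pairs {..<m} \<union> {{0, m}, {1, m}}" for e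
    using that clique_bij_betw_edges[OF K(1) g] fp[of 0] fp[of 1] K m by auto
  ultimately show "contains_copy G (clique_ear m)"
    unfolding contains_copy_iff[OF G forbidden_graphs_fin(1)[OF m]]
    by (intro exI[of _ ?g]) (simp add: clique_ear_def)
qed

lemma contains_clique_bowtie_iff:
  assumes G: "G \<in> fin_graphs" and m: "m \<ge> 2"
  shows "contains_copy G (clique_bowtie m) \<longleftrightarrow> has_bowtie m G"
proof -
  let ?A = "{..<m}" and ?B = "insert 0 {m..<2 * m - 1}"
  have AB: "{..<2 * m - 1} = ?A \<union> ?B" "?A \<inter> ?B = {0}" "card ?A = m" "card ?B = m"
    using m by (auto simp: card_insert_if)
  show ?thesis
  proof
    assume "contains_copy G (clique_bowtie m)"
    then obtain f where f: "inj_on f (?A \<union> ?B)" "f ` (?A \<union> ?B) \<subseteq> verts G"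
      and e': "\<forall>e\<in>vertex_pairs ?A \<union> vertex_pairs ?B. f ` e \<in> edges G"
      unfolding contains_copy_iff[OF G forbidden_graphs_fin(2)[OF m]]
        unfolding clique_bowtie_def fst_conv snd_conv AB(1) by (elim exE conjE) (rule that)
    note e = bspec[OF e']
    have "clique (card ?A) G (f ` ?A)" "clique (card ?B) G (f ` ?B)"
      by (rule clique_image[OF inj_on_subset[OF f(1)] order_trans[OF image_mono f(2)] e]; blast)+
    moreover have "f ` ?A \<inter> f ` ?B = f ` {0}"
      using inj_on_image_Int[OF f(1) Un_upper1 Un_upper2] AB(2) by simp
    ultimately show "has_bowtie m G" unfolding has_bowtie_def AB
      by (intro exI[of _ "f ` ?A"] exI[of _ "f ` ?B"]) simp
  next
    assume "has_bowtie m G"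
    then obtain K L c where K: "clique m G K" and L: "clique m G L" and c: "K \<inter> L = {c}"
      unfolding has_bowtie_def by (auto simp: card_1_singleton_iff)
    obtain f where f: "bij_betw f ?A K" "\<And>y. y \<in> {0} \<Longrightarrow> f y = c"
      by (rule ex_bij_betw_extending[of ?A K "{0}" "\<lambda>_. c"])
        (use c m AB clique_finite[OF G K] cliqueD(2)[OF K] in auto)
    obtain g where g: "bij_betw g ?B L" "\<And>y. y \<in> {0} \<Longrightarrow> g y = c"
      by (rule ex_bij_betw_extending[of ?B L "{0}" "\<lambda>_. c"])
        (use c m AB clique_finite[OF G L] cliqueD(2)[OF L] in auto)
    \<comment> \<open>Both labellings send the shared label \<open>0\<close> to the shared vertex
      \<open>c\<close>, so the glued map agrees with \<open>g\<close> on all of the second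
      block.\<close>
    define h where "h x = (if x < m then f x else g x)" for x
    have hA: "bij_betw h ?A K"
      using f(1) by (rule bij_betw_cong[THEN iffD1, rotated]) (simp add: h_def)
    have hB: "bij_betw h ?B L"
      using g(1) by (rule bij_betw_cong[THEN iffD1, rotated]) (use f(2) g(2) in \<open>auto simp: h_def\<close>)
    have h0: "h 0 = c" using f(2) m by (simp add: h_def)
    \<comment> \<open>A collision between the two private parts would lie in both cliques, hence
      equal \<open>c\<close>; but on the first block only \<open>0\<close> is sent to
      \<open>c\<close>.\<close>
    have "h x \<noteq> h y" if x: "x \<in> ?A - ?B" and y: "y \<in> ?B - ?A" for x y
    proof
      assume eq: "h x = h y"
      have "h x \<in> K" "h y \<in> L" using x y bij_betwE[OF hA] bij_betwE[OF hB] by blast+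
      then have "h x = h 0" using eq c h0 by auto
      then have "x = 0" using x m inj_onD[OF bij_betw_imp_inj_on[OF hA]] by auto
      then show False using x by simp
    qed
    then have "h ` (?A - ?B) \<inter> h ` (?B - ?A) = {}" by blast
    then have "inj_on h (?A \<union> ?B)"
      unfolding inj_on_Un using hA hB by (blast dest: bij_betw_imp_inj_on)
    moreover have "h ` (?A \<union> ?B) \<subseteq> verts G"
      unfolding image_Un bij_betw_imp_surj_on[OF hA] bij_betw_imp_surj_on[OF hB]
      using cliqueD(1)[OF K] cliqueD(1)[OF L] by simp
    moreover have "\<forall>e\<in>vertex_pairs ?A \<union> vertex_pairs ?B. h ` e \<in> edges G"
      using clique_bij_betw_edges[OF K hA] clique_bij_betw_edges[OF L hB] by blast
    ultimately show "contains_copy G (clique_bowtie m)"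
      unfolding contains_copy_iff[OF G forbidden_graphs_fin(2)[OF m]]
      unfolding clique_bowtie_def fst_conv snd_conv AB(1) by (intro exI[of _ h] conjI)
  qed
qed

lemma contains_clique_dumbbell_iff:
  assumes G: "G \<in> fin_graphs" and m: "m \<ge> 2"
  shows "contains_copy G (clique_dumbbell m) \<longleftrightarrow> has_dumbbell m G"
proof -
  let ?A = "{..<m}" and ?B = "{m..<2 * m}"
  have AB: "{..<2 * m} = ?A \<union> ?B" "?A \<inter> ?B = {}" "card ?A = m" "card ?B = m"
    by auto
  show ?thesis
  proof
    assume "contains_copy G (clique_dumbbell m)"
    then obtain f where f: "inj_on f (?A \<union> ?B)" "f ` (?A \<union> ?B) \<subseteq> verts G"
      and e': "\<forall>e\<in>vertex_pairs ?A \<union> vertex_pairs ?B \<union> {{0, m}}. f ` e \<in> edges G"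
      unfolding contains_copy_iff[OF G forbidden_graphs_fin(3)[OF m]]
        unfolding clique_dumbbell_def fst_conv snd_conv AB(1) by (elim exE conjE) (rule that)
    note e = bspec[OF e']
    have "clique (card ?A) G (f ` ?A)" "clique (card ?B) G (f ` ?B)"
      by (rule clique_image[OF inj_on_subset[OF f(1)] order_trans[OF image_mono f(2)] e]; blast)+
    moreover have "f ` ?A \<inter> f ` ?B = {}"
      using inj_on_image_Int[OF f(1) Un_upper1 Un_upper2] AB(2) by simp
    moreover have "{f 0, f m} \<in> edges G" using e[of "{0, m}"] by simp
    ultimately show "has_dumbbell m G" unfolding has_dumbbell_def AB using m
      by (intro exI[of _ "f ` ?A"] exI[of _ "f ` ?B"] exI[of _ "f 0"] exI[of _ "f m"]) simp
  next
    assume "has_dumbbell m G"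
    then obtain K L a b where K: "clique m G K" and L: "clique m G L" and KL: "K \<inter> L = {}"
      and ab: "a \<in> K" "b \<in> L" "{a, b} \<in> edges G"
      unfolding has_dumbbell_def by blast
    obtain f where f: "bij_betw f ?A K" "\<And>y. y \<in> {0} \<Longrightarrow> f y = a"
      by (rule ex_bij_betw_extending[of ?A K "{0}" "\<lambda>_. a"])
        (use ab m clique_finite[OF G K] cliqueD(2)[OF K] in auto)
    obtain g where g: "bij_betw g ?B L" "\<And>y. y \<in> {m} \<Longrightarrow> g y = b"
      by (rule ex_bij_betw_extending[of ?B L "{m}" "\<lambda>_. b"])
        (use ab m clique_finite[OF G L] cliqueD(2)[OF L] in auto)
    let ?h = "\<lambda>x. if x < m then f x else g x"
    have hA: "bij_betw ?h ?A K" using f(1) by (rule bij_betw_cong[THEN iffD1, rotated]) auto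
    have hB: "bij_betw ?h ?B L" using g(1) by (rule bij_betw_cong[THEN iffD1, rotated]) auto
    have "bij_betw ?h (?A \<union> ?B) (K \<union> L)" using hA hB KL by (rule bij_betw_combine)
    then have "inj_on ?h (?A \<union> ?B)" "?h ` (?A \<union> ?B) \<subseteq> verts G"
      using cliqueD(1)[OF K] cliqueD(1)[OF L] by (simp_all add: bij_betw_def)
    moreover have "?h ` {0, m} \<in> edges G" using f(2) g(2) ab(3) m by (simp add: insert_commute)
    ultimately show "contains_copy G (clique_dumbbell m)"
      unfolding contains_copy_iff[OF G forbidden_graphs_fin(3)[OF m]]
      using clique_bij_betw_edges[OF K hA] clique_bij_betw_edges[OF L hB]
      by (intro exI[of _ ?h]) (auto simp: clique_dumbbell_def AB(1))
  qed
qed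

lemma contains_forbidden_family_iff:
  assumes "G \<in> fin_graphs" "m \<ge> 2"
  shows "contains_member G (forbidden_family m) \<longleftrightarrow> forbidden m G"
  using assms forbidden_graphs_fin[of m]
  unfolding forbidden_family_def
  by (subst contains_member_iso_classes)
    (auto simp: forbidden_def contains_clique_ear_iff contains_clique_bowtie_iff
      contains_clique_dumbbell_iff)

lemma forbidden_family_subset: "m \<ge> 2 \<Longrightarrow> forbidden_family m \<subseteq> iso_classes"
  using forbidden_graphs_fin[of m]
  by (auto simp: forbidden_family_def iso_classes_def intro!: quotientI simp del: prod.collapse)

section \<open>Size of the family and its dependence on \<open>m\<close>\<close>

lemma card_verts_forbidden:
  "card (verts (clique_ear m)) = m + 1" "card (verts (clique_bowtie m)) = 2 * m - 1"
  "card (verts (clique_dumbbell m)) = 2 * m"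
  by (simp_all add: clique_ear_def clique_bowtie_def clique_dumbbell_def)

text \<open>The vertex counts \<open>m + 1\<close>, \<open>2 * m - 1\<close> and
  \<open>2 * m\<close> are distinct from \<open>m = 3\<close> on; for \<open>m = 2\<close> the first
  two coincide.\<close>

lemma card_forbidden_family:
  assumes "m \<ge> 3"
  shows "card (forbidden_family m) = 3"
proof -
  have fin: "clique_ear m \<in> fin_graphs" "clique_bowtie m \<in> fin_graphs"
    using assms by (auto intro: forbidden_graphs_fin)
  have "graph_iso `` {clique_ear m} \<noteq> graph_iso `` {clique_bowtie m}"
    "graph_iso `` {clique_ear m} \<noteq> graph_iso `` {clique_dumbbell m}"
    "graph_iso `` {clique_bowtie m} \<noteq> graph_iso `` {clique_dumbbell m}"
    using iso_class_eq_card_verts[OF fin(1), of "clique_bowtie m"]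
      iso_class_eq_card_verts[OF fin(1), of "clique_dumbbell m"]
      iso_class_eq_card_verts[OF fin(2), of "clique_dumbbell m"] assms
    unfolding card_verts_forbidden by linarith+
  then show ?thesis by (simp add: forbidden_family_def)
qed

text \<open>The ear graph for \<open>m\<close> has \<open>m + 1\<close> vertices, while every member
  of the family for \<open>m'\<close> has at least \<open>m' + 1\<close>. Used in both directions,
  this yields injectivity.\<close>

lemma forbidden_family_le:
  assumes "m \<ge> 2" "m' \<ge> 2" "forbidden_family m = forbidden_family m'"
  shows "m' \<le> m"
proof -
  have "graph_iso `` {clique_ear m} \<in> forbidden_family m'"
    unfolding assms(3)[symmetric] by (simp add: forbidden_family_def)
  then have "card (verts (clique_ear m)) \<in>
      (\<lambda>H. card (verts H)) ` {clique_ear m', clique_bowtie m', clique_dumbbell m'}"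
    unfolding forbidden_family_def
    by (auto dest!: iso_class_eq_card_verts[OF forbidden_graphs_fin(1)[OF assms(1)]])
  then have "m + 1 \<in> {m' + 1, 2 * m' - 1, 2 * m'}" by (simp add: card_verts_forbidden)
  then show ?thesis using assms by auto
qed

lemma inj_on_forbidden_family: "inj_on forbidden_family {2..}"
  by (rule inj_onI) (metis atLeast_iff forbidden_family_le le_antisym)

lemma saturated_iff:
  assumes "m \<ge> 2"
  shows "saturated (forbidden_family m) G \<longleftrightarrow> G \<in> fin_graphs \<and> \<not> forbidden m G \<and>
    (\<forall>u\<in>verts G. \<forall>v\<in>verts G. u \<noteq> v \<longrightarrow> {u, v} \<notin> edges G \<longrightarrow> forbidden m (add_edge {u, v} G))"
proof (cases "G \<in> fin_graphs")
  case True
  have "add_edge {u, v} G \<in> fin_graphs" if "u \<in> verts G" "v \<in> verts G" "u \<noteq> v" for u v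
    using that True by (auto simp: add_edge_def fin_graphs_def)
  then have "contains_member (add_edge {u, v} G) (forbidden_family m) \<longleftrightarrow>
      forbidden m (add_edge {u, v} G)" if "u \<in> verts G" "v \<in> verts G" "u \<noteq> v" for u v
    using that assms by (intro contains_forbidden_family_iff)
  moreover have "(\<forall>e\<in>vertex_pairs (verts G) - edges G. P e) \<longleftrightarrow>
      (\<forall>u\<in>verts G. \<forall>v\<in>verts G. u \<noteq> v \<longrightarrow> {u, v} \<notin> edges G \<longrightarrow> P {u, v})" for P
    by (auto elim!: vertex_pairsE)
  ultimately show ?thesis
    unfolding saturated_def contains_forbidden_family_iff[OF True assms] by simp
qed (simp add: saturated_def)

section \<open>Saturated graphs\<close>

definition nbrs :: "graph \<Rightarrow> nat \<Rightarrow> nat set" where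
  "nbrs G v = {u. {v, u} \<in> edges G}"

lemma nbrs_subset: "G \<in> fin_graphs \<Longrightarrow> nbrs G v \<subseteq> verts G - {v}"
  by (auto simp: nbrs_def dest: edges_doubletonD)

lemma finite_nbrs: "G \<in> fin_graphs \<Longrightarrow> finite (nbrs G v)"
  by (rule finite_subset[OF nbrs_subset]) (auto simp: fin_graphs_def)

text \<open>The handshake identity: incidences of vertices and edges are counted in both
  orders.\<close>

lemma sum_card_nbrs:
  assumes G: "G \<in> fin_graphs"
  shows "(\<Sum>v\<in>verts G. card (nbrs G v)) = 2 * card (edges G)"
proof -
  have fin: "finite (verts G)" "finite (edges G)" using G finite_edges by (auto simp: fin_graphs_def)
  have "card (nbrs G v) = card {e \<in> edges G. v \<in> e}" for v
  proof (rule bij_betw_same_card)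
    show "bij_betw (\<lambda>u. {v, u}) (nbrs G v) {e \<in> edges G. v \<in> e}"
      unfolding bij_betw_def
    proof
      show "inj_on (\<lambda>u. {v, u}) (nbrs G v)" by (auto simp: inj_on_def doubleton_eq_iff)
      show "(\<lambda>u. {v, u}) ` nbrs G v = {e \<in> edges G. v \<in> e}"
      proof (intro equalityI subsetI)
        fix e assume e: "e \<in> {e \<in> edges G. v \<in> e}"
        then have "e \<in> vertex_pairs (verts G)" using G by (auto simp: fin_graphs_def)
        then obtain a b where "e = {a, b}" by (rule vertex_pairsE)
        then show "e \<in> (\<lambda>u. {v, u}) ` nbrs G v"
          using e by (auto simp: nbrs_def insert_commute)
      qed (auto simp: nbrs_def)
    qed
  qed
  then have "(\<Sum>v\<in>verts G. card (nbrs G v)) = (\<Sum>v\<in>verts G. \<Sum>e\<in>edges G. if v \<in> e then 1 else 0)"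
    using fin by (simp add: sum.If_cases Int_def)
  also have "\<dots> = (\<Sum>e\<in>edges G. \<Sum>v\<in>verts G. if v \<in> e then 1 else 0)" by (rule sum.swap)
  also have "\<dots> = (\<Sum>e\<in>edges G. 2)"
  proof (rule sum.cong)
    fix e assume "e \<in> edges G"
    then have "verts G \<inter> e = e" "card e = 2" using G by (auto simp: fin_graphs_def vertex_pairs_def)
    then show "(\<Sum>v\<in>verts G. if v \<in> e then 1 else 0) = (2::nat)" using fin by (simp add: sum.If_cases)
  qed simp
  finally show ?thesis by simp
qed

text \<open>Meeting in exactly one vertex is a bowtie. If two vertices are shared, any vertex of
  \<open>L\<close> outside \<open>K\<close> is adjacent to both and forms an ear on
  \<open>K\<close>.\<close>

lemma cliques_disjoint:
  assumes G: "G \<in> fin_graphs" and free: "\<not> forbidden m G"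
    and K: "clique m G K" and L: "clique m G L" and ne: "K \<noteq> L"
  shows "K \<inter> L = {}"
proof (rule ccontr)
  assume "K \<inter> L \<noteq> {}"
  have fin: "finite K" "finite L" using clique_finite G K L by auto
  have "card (K \<inter> L) \<noteq> 1" using free K L by (auto simp: forbidden_def has_bowtie_def)
  with \<open>K \<inter> L \<noteq> {}\<close> fin have "2 \<le> card (K \<inter> L)"
    by (metis One_nat_def Suc_1 card_0_eq finite_Int le_less_linear less_2_cases)
  then obtain T where "T \<subseteq> K \<inter> L" "card T = 2" by (meson obtain_subset_with_card_n)
  then obtain a b where ab: "a \<in> K" "a \<in> L" "b \<in> K" "b \<in> L" "a \<noteq> b"
    by (auto simp: card_2_iff)
  have "\<not> L \<subseteq> K" using ne fin cliqueD(2)[OF K] cliqueD(2)[OF L] card_subset_eq by metis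
  then obtain x where x: "x \<in> L" "x \<notin> K" by blast
  then have "{a, x} \<in> edges G" "{b, x} \<in> edges G" using ab cliqueD(3)[OF L] by metis+
  then show False using free K ab x unfolding forbidden_def has_ear_def by blast
qed

section \<open>Lower bound on the edges when \<open>m\<close> does not divide
  \<open>n\<close>\<close>

lemma clique_add_edge:
  assumes "clique m (add_edge {r, v} G) K" "\<not> {r, v} \<subseteq> K"
  shows "clique m G K"
  using assms by (auto simp: clique_def add_edge_def vertex_pairs_def)

text \<open>The forbidden configuration created by the edge \<open>{r, v}\<close> must include a new
  clique through \<open>r\<close> and \<open>v\<close>, whose other \<open>m - 2\<close> vertices
  are common neighbours. Otherwise all cliques are old and avoid \<open>r\<close>, which leaves no
  place for the new edge once \<open>far\<close> is assumed.\<close>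

lemma common_nbrs:
  assumes m: "m \<ge> 2" and sat: "saturated (forbidden_family m) G"
    and r: "r \<in> verts G" "\<And>K. clique m G K \<Longrightarrow> r \<notin> K"
    and v: "v \<in> verts G" "v \<noteq> r" "v \<notin> nbrs G r"
    and far: "\<And>K. clique m G K \<Longrightarrow> v \<in> K \<Longrightarrow> K \<inter> nbrs G r = {}"
  shows "m - 2 \<le> card (nbrs G v \<inter> nbrs G r)"
proof -
  let ?G = "add_edge {r, v} G"
  have G: "G \<in> fin_graphs" and free: "\<not> forbidden m G" and forb: "forbidden m ?G"
    using sat r v unfolding saturated_iff[OF m] by (auto simp: nbrs_def)
  have edge: "{a, b} \<in> edges G \<or> {a, b} = {r, v}" if "{a, b} \<in> edges ?G" for a b
    using that by (auto simp: add_edge_def)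
  have "\<exists>K. clique m ?G K \<and> {r, v} \<subseteq> K"
  proof (rule ccontr)
    assume "\<not> ?thesis"
    then have old: "clique m G K" if "clique m ?G K" for K using clique_add_edge that by blast
    \<comment> \<open>A foot of the ear lies in an old clique and so is not \<open>r\<close>. A new
      ear edge therefore has foot \<open>v\<close> and tip \<open>r\<close>; the other foot is then
      a neighbour of \<open>r\<close> in the clique of \<open>v\<close>, against
      \<open>far\<close>.\<close>
    have no_ear: False if "clique m ?G K" "x \<notin> K" "a \<in> K" "b \<in> K" "a \<noteq> b"
      "{a, x} \<in> edges ?G" "{b, x} \<in> edges ?G" "{a, x} \<notin> edges G" for K x a b
    proof -
      have "{a, x} = {r, v}" using edge that by blast
      moreover have "a \<noteq> r" using old r that by blast
      ultimately have ax: "a = v" "x = r" by (auto simp: doubleton_eq_iff)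
      then have "{b, x} \<in> edges G" using edge[of b x] that v by (auto simp: doubleton_eq_iff)
      then show False using ax far[OF old[OF that(1)]] that by (auto simp: nbrs_def insert_commute)
    qed
    from forb show False unfolding forbidden_def
    proof (elim disjE)
      assume "has_ear m ?G"
      then obtain K x a b where K: "clique m ?G K" "x \<notin> K" "a \<in> K" "b \<in> K" "a \<noteq> b"
        "{a, x} \<in> edges ?G" "{b, x} \<in> edges ?G" unfolding has_ear_def by blast
      then have "{a, x} \<in> edges G" "{b, x} \<in> edges G"
        using no_ear[of K x a b] no_ear[of K x b a] by auto
      then show False using free K old unfolding forbidden_def has_ear_def by blast
    next
      assume "has_bowtie m ?G"
      \<comment> \<open>A bowtie consists of clique edges only, so it was present already.\<close>
      then show False using free old unfolding forbidden_def has_bowtie_def by blast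
    next
      assume "has_dumbbell m ?G"
      then obtain K L a b where K: "clique m G K" "clique m G L" "K \<inter> L = {}" "a \<in> K" "b \<in> L"
        "{a, b} \<in> edges ?G" using old unfolding has_dumbbell_def by blast
      \<comment> \<open>Both ends of the connecting edge lie in old cliques, so it cannot be the new
        edge.\<close>
      then have "a \<noteq> r" "b \<noteq> r" using r by blast+
      then have "{a, b} \<in> edges G" using edge[OF K(6)] by (auto simp: doubleton_eq_iff)
      then show False using free K unfolding forbidden_def has_dumbbell_def by blast
    qed
  qed
  then obtain K where K: "clique m ?G K" "r \<in> K" "v \<in> K" by blast
  have "K - {r, v} \<subseteq> nbrs G v \<inter> nbrs G r"
  proof
    fix x assume x: "x \<in> K - {r, v}"
    then have "{v, x} \<in> edges ?G" "{r, x} \<in> edges ?G" using K cliqueD(3)[OF K(1)] by auto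
    then show "x \<in> nbrs G v \<inter> nbrs G r"
      using edge[of v x] edge[of r x] x by (auto simp: nbrs_def doubleton_eq_iff)
  qed
  then have "card (K - {r, v}) \<le> card (nbrs G v \<inter> nbrs G r)"
    using finite_nbrs[OF G] by (intro card_mono) auto
  moreover have "card (K - {r, v}) = m - 2"
    using K v cliqueD(2)[OF K(1)] by (subst card_Diff_subset) auto
  ultimately show ?thesis by simp
qed

text \<open>Each neighbour of \<open>r\<close>, together with its clique if it has one, spoils at
  most \<open>m\<close> vertices. Every remaining vertex other than \<open>r\<close> satisfies
  \<open>common_nbrs\<close> and sends \<open>m - 2\<close> edges into the neighbourhood of
  \<open>r\<close>.\<close>

lemma edges_ge_of_low_degree:
  assumes m: "m \<ge> 2" and sat: "saturated (forbidden_family m) G"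
    and r: "r \<in> verts G" "\<And>K. clique m G K \<Longrightarrow> r \<notin> K"
  shows "(m - 2) * (card (verts G) - 1 - m * card (nbrs G r)) \<le> card (edges G)"
proof -
  have G: "G \<in> fin_graphs" and free: "\<not> forbidden m G"
    using sat unfolding saturated_iff[OF m] by auto
  define S where "S x = insert x (\<Union>{K. clique m G K \<and> x \<in> K})" for x
  define U where "U = verts G - {r} - (\<Union>x\<in>nbrs G r. S x)"
  have fin: "finite (verts G)" "finite U" using G by (auto simp: fin_graphs_def U_def)
  have S: "finite (S x) \<and> card (S x) \<le> m" for x
  proof (cases "\<exists>K. clique m G K \<and> x \<in> K")
    case True
    then obtain K where K: "clique m G K" "x \<in> K" by blast
    \<comment> \<open>By disjointness a vertex lies in at most one \<open>m\<close>-clique, which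
      bounds \<open>S x\<close> by \<open>m\<close>.\<close>
    then have "{K. clique m G K \<and> x \<in> K} = {K}" using cliques_disjoint[OF G free] by blast
    then have "S x = K" using K by (auto simp: S_def)
    then show ?thesis using K clique_finite[OF G] cliqueD(2) by auto
  next
    case False
    then have "S x = {x}" by (auto simp: S_def)
    then show ?thesis using m by simp
  qed
  have "card (\<Union>x\<in>nbrs G r. S x) \<le> (\<Sum>x\<in>nbrs G r. card (S x))"
    using finite_nbrs[OF G] by (rule card_UN_le)
  also have "\<dots> \<le> (\<Sum>x\<in>nbrs G r. m)" using S by (intro sum_mono) auto
  finally have cS: "card (\<Union>x\<in>nbrs G r. S x) \<le> m * card (nbrs G r)" by (simp add: mult.commute)
  have finS: "finite (\<Union>x\<in>nbrs G r. S x)" using S finite_nbrs[OF G] by auto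
  have "card (verts G) - 1 - m * card (nbrs G r) \<le> card (verts G - {r}) - card (\<Union>x\<in>nbrs G r. S x)"
    using cS r fin by simp
  also have "\<dots> \<le> card U" unfolding U_def using finS by (rule diff_card_le_card_Diff)
  finally have cU: "card (verts G) - 1 - m * card (nbrs G r) \<le> card U" .
  have "m - 2 \<le> card (nbrs G v \<inter> nbrs G r)" if "v \<in> U" for v
  proof (rule common_nbrs[OF m sat r])
    show "v \<in> verts G" "v \<noteq> r" "v \<notin> nbrs G r" using that by (auto simp: U_def S_def)
    show "K \<inter> nbrs G r = {}" if "clique m G K" "v \<in> K" for K
      using that \<open>v \<in> U\<close> by (auto simp: U_def S_def)
  qed
  then have "(\<Sum>v\<in>U. m - 2) \<le> (\<Sum>v\<in>U. card (nbrs G v \<inter> nbrs G r))" by (intro sum_mono)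
  also have "\<dots> = card (Sigma U (\<lambda>v. nbrs G v \<inter> nbrs G r))"
    using fin finite_nbrs[OF G] by (subst card_SigmaI) auto
  also have "\<dots> \<le> card (edges G)"
  proof (rule card_inj_on_le)
    \<comment> \<open>Since \<open>x\<close> is in \<open>S x\<close>, the set \<open>U\<close>
      avoids the neighbourhood of \<open>r\<close>. Hence an edge \<open>{v, x}\<close> determines
      which end is \<open>v\<close>, and no edge is counted twice.\<close>
    have "U \<inter> nbrs G r = {}" by (auto simp: U_def S_def)
    then show "inj_on (\<lambda>(v, x). {v, x}) (Sigma U (\<lambda>v. nbrs G v \<inter> nbrs G r))"
      by (auto simp: inj_on_def doubleton_eq_iff)
    show "(\<lambda>(v, x). {v, x}) ` Sigma U (\<lambda>v. nbrs G v \<inter> nbrs G r) \<subseteq> edges G"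
      by (auto simp: nbrs_def)
  qed (rule finite_edges[OF G])
  finally have "(m - 2) * card U \<le> card (edges G)" by (simp add: mult.commute)
  then show ?thesis using cU by (meson le_trans mult_le_mono2)
qed

text \<open>If the pairwise disjoint \<open>m\<close>-cliques covered all vertices, their sizes
  would add up to a multiple of \<open>m\<close>.\<close>

lemma ex_vertex_outside_cliques:
  assumes G: "G \<in> fin_graphs" and free: "\<not> forbidden m G" and n: "\<not> m dvd card (verts G)"
  obtains r where "r \<in> verts G" "\<And>K. clique m G K \<Longrightarrow> r \<notin> K"
proof -
  let ?C = "{K. clique m G K}"
  have "\<Union>?C \<noteq> verts G"
  proof
    assume U: "\<Union>?C = verts G"
    have "card (\<Union>?C) = (\<Sum>K\<in>?C. card K)"
    proof (rule card_Union_disjoint)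
      show "pairwise disjnt ?C"
        using cliques_disjoint[OF G free] by (auto simp: pairwise_def disjnt_def)
    qed (use clique_finite[OF G] in auto)
    also have "\<dots> = (\<Sum>K\<in>?C. m)" by (rule sum.cong) (auto dest: cliqueD)
    finally show False using n U by simp
  qed
  moreover have "\<Union>?C \<subseteq> verts G" by (auto dest: cliqueD)
  ultimately show thesis using that by blast
qed

lemma clique_degree:
  assumes "G \<in> fin_graphs" "clique m G K" "v \<in> K"
  shows "m - 1 \<le> card (nbrs G v)"
proof -
  have "K - {v} \<subseteq> nbrs G v" using assms cliqueD(3)[OF assms(2)] by (auto simp: nbrs_def)
  then have "card (K - {v}) \<le> card (nbrs G v)" using finite_nbrs[OF assms(1)] by (rule card_mono[rotated])
  then show ?thesis using assms clique_finite cliqueD(2)[OF assms(2)] by simp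
qed

text \<open>The slope exceeds that of disjoint cliques by \<open>1 / (8 * m ^ 2)\<close>; the
  subtracted \<open>m\<close> absorbs the lower order terms of both cases.\<close>

lemma edges_lower_bound:
  assumes m: "m \<ge> 4" and sat: "saturated (forbidden_family m) G"
    and n: "card (verts G) = n" "\<not> m dvd n" and large: "4 * m ^ 3 \<le> n"
  shows "((real m - 1) / 2 + 1 / (8 * real m ^ 2)) * real n - real m \<le> real (card (edges G))"
proof -
  have m2: "m \<ge> 2" using m by simp
  have G: "G \<in> fin_graphs" and free: "\<not> forbidden m G"
    using sat unfolding saturated_iff[OF m2] by auto
  have fin: "finite (verts G)" using G by (simp add: fin_graphs_def)
  \<comment> \<open>The degree threshold. It keeps the loss \<open>m * t * (m - 2)\<close> of the
    low-degree case below \<open>n / 4\<close>, and \<open>t / 2\<close> is the gain claimed over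
    \<open>(m - 1) * n / 2\<close>.\<close>
  define t where "t = real n / (4 * real m ^ 2)"
  have t: "8 * (real m ^ 2) * t = 2 * real n" using m by (simp add: t_def)
  have "1 / (8 * real m ^ 2) * real n = t / 2" by (simp add: t_def)
  then have bound: "((real m - 1) / 2 + 1 / (8 * real m ^ 2)) * real n = (real m * real n - real n) / 2 + t / 2"
    unfolding distrib_right by (simp add: algebra_simps)
  have "real (4 * m ^ 3) \<le> real n" using large by (simp only: of_nat_le_iff)
  \<comment> \<open>The bound \<open>large\<close> amounts to \<open>m <= t\<close>, so vertices of
    degree at least \<open>t\<close> also have degree at least \<open>m - 1\<close>.\<close>
  then have tm: "real m \<le> t" using m by (simp add: t_def field_simps power2_eq_square power3_eq_cube)
  obtain r where r: "r \<in> verts G" "\<And>K. clique m G K \<Longrightarrow> r \<notin> K"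
    using ex_vertex_outside_cliques[OF G free] n by blast
  show ?thesis
  proof (cases "\<exists>r\<in>verts G. (\<forall>K. clique m G K \<longrightarrow> r \<notin> K) \<and> real (card (nbrs G r)) \<le> t")
    case True
    then obtain r where r: "r \<in> verts G" "\<And>K. clique m G K \<Longrightarrow> r \<notin> K"
      and d: "real (card (nbrs G r)) \<le> t" by blast
    let ?d = "card (nbrs G r)"
    have "(real m - 2) * (real n - 1 - real m * t) \<le> (real m - 2) * (real n - 1 - real m * real ?d)"
      using m d by (intro mult_left_mono diff_left_mono) auto
    also have "\<dots> \<le> (real m - 2) * real (n - 1 - m * ?d)"
    proof (rule mult_left_mono)
      \<comment> \<open>Truncated subtraction never falls below the integer difference, so the real
        bound stays valid even when that difference is negative.\<close>
      have "int n - 1 - int (m * ?d) \<le> int (n - 1 - m * ?d)" by linarith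
      then have "real_of_int (int n - 1 - int (m * ?d)) \<le> real_of_int (int (n - 1 - m * ?d))"
        by (simp only: of_int_le_iff)
      then show "real n - 1 - real m * real ?d \<le> real (n - 1 - m * ?d)" by simp
    qed (use m in simp)
    also have "\<dots> = real ((m - 2) * (n - 1 - m * ?d))" using m by (simp add: of_nat_diff)
    also have "\<dots> \<le> real (card (edges G))"
      using edges_ge_of_low_degree[OF m2 sat r] n by (simp only: of_nat_le_iff)
    finally have e: "(real m - 2) * (real n - 1 - real m * t) \<le> real (card (edges G))" .
    have "real m * t * (real m - 2) \<le> real m ^ 2 * t"
      using m tm by (simp add: algebra_simps power2_eq_square)
    also have "\<dots> = real n / 4" using t by (simp add: algebra_simps)
    finally have 1: "real m * t * (real m - 2) \<le> real n / 4" .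
    have 2: "4 * real n \<le> real m * real n" using m by (intro mult_right_mono) auto
    have "16 * t \<le> real m ^ 2 * t" using m tm power_mono[of 4 "real m" 2] by (intro mult_right_mono) auto
    then have 3: "t \<le> real n / 64" using t by (simp add: mult.commute)
    have "(real m - 2) * (real n - 1 - real m * t) =
        real m * real n - 2 * real n - real m + 2 - real m * t * (real m - 2)"
      by (simp add: algebra_simps)
    with e 1 have "real m * real n - 2 * real n - real m + 2 - real n / 4 \<le> real (card (edges G))"
      by simp
    \<comment> \<open>The surplus over the target is
      \<open>m * n / 2 - 7 * n / 4 - t / 2 + 2\<close>. By \<open>2\<close> and \<open>3\<close> it
      is at least \<open>n / 4 - n / 128 + 2\<close>; the assumption \<open>m >= 4\<close> enters
      through \<open>2\<close>.\<close>
    then show ?thesis unfolding bound using 2 3 of_nat_0_le_iff[of n, where 'a=real] by argo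
  next
    case False
    then have big: "t \<le> real (card (nbrs G v))" if "v \<in> verts G" "\<And>K. clique m G K \<Longrightarrow> v \<notin> K" for v
      using that by (meson le_cases)
    have deg: "real m - 1 \<le> real (card (nbrs G v))" if "v \<in> verts G" for v
    proof (cases "\<exists>K. clique m G K \<and> v \<in> K")
      case True
      then have "m - 1 \<le> card (nbrs G v)" using clique_degree[OF G] by blast
      then show ?thesis by linarith
    next
      case False
      then show ?thesis using big[OF that] tm by force
    qed
    have "n \<ge> 1" using n(2) by (cases n) auto
    \<comment> \<open>In the degree sum \<open>r\<close> contributes at least \<open>t\<close> and
      every other vertex at least \<open>m - 1\<close>.\<close>
    then have "(real m - 1) * (real n - 1) + t = (\<Sum>v\<in>verts G - {r}. real m - 1) + t"
      using fin r n by (simp add: of_nat_diff)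
    also have "\<dots> \<le> (\<Sum>v\<in>verts G - {r}. real (card (nbrs G v))) + real (card (nbrs G r))"
      using deg big[OF r] by (intro add_mono sum_mono) auto
    also have "\<dots> = real (\<Sum>v\<in>verts G. card (nbrs G v))"
      using fin r by (simp add: sum.remove[of _ r])
    finally have "(real m - 1) * (real n - 1) + t \<le> 2 * real (card (edges G))"
      unfolding sum_card_nbrs[OF G] by simp
    moreover have "(real m - 1) * (real n - 1) = real m * real n - real n - real m + 1"
      by (simp add: algebra_simps)
    ultimately have "real m * real n - real n - real m + 1 + t \<le> 2 * real (card (edges G))"
      by simp
    then show ?thesis unfolding bound using of_nat_0_le_iff[of m, where 'a=real] by argo
  qed
qed

section \<open>Existence of saturated graphs and the disjoint cliques\<close>

lemma ex_saturated:
  assumes m: "m \<ge> 2"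
  shows "\<exists>G. saturated (forbidden_family m) G \<and> card (verts G) = n"
proof -
  let ?P = "vertex_pairs {..<n}"
  let ?\<E> = "{E. E \<subseteq> ?P \<and> \<not> forbidden m ({..<n}, E)}"
  have "finite ?P" by (rule finite_subset[of _ "Pow {..<n}"]) (auto simp: vertex_pairs_def)
  then have "finite ?\<E>" by (intro finite_subset[of ?\<E> "Pow ?P"]) auto
  moreover have "{} \<in> ?\<E>"
  proof -
    have "\<not> clique m ({..<n}, {}) K" for K
    proof
      assume K: "clique m ({..<n}, {}) K"
      then obtain T where "T \<subseteq> K" "card T = 2"
        using m obtain_subset_with_card_n[of 2 K] cliqueD(2)[OF K] by metis
      then show False using K by (auto simp: clique_def vertex_pairs_def)
    qed
    then show ?thesis by (simp add: forbidden_def has_ear_def has_bowtie_def has_dumbbell_def)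
  qed
  \<comment> \<open>The edgeless graph contains no \<open>m\<close>-clique, so some edge set is
    admissible; an inclusion-maximal one is saturated.\<close>
  ultimately have "\<exists>E\<in>?\<E>. \<forall>E'\<in>?\<E>. E \<subseteq> E' \<longrightarrow> E = E'"
    by (intro finite_has_maximal) auto
  then obtain E where E: "E \<in> ?\<E>" and max: "\<forall>E'\<in>?\<E>. E \<subseteq> E' \<longrightarrow> E = E'"
    by (elim bexE)
  let ?G = "({..<n}, E)"
  have "saturated (forbidden_family m) ?G"
    unfolding saturated_iff[OF m]
  proof (intro conjI ballI impI)
    show "?G \<in> fin_graphs" "\<not> forbidden m ?G" using E by (auto simp: fin_graphs_def)
    fix u v assume "u \<in> verts ?G" "v \<in> verts ?G" "u \<noteq> v" "{u, v} \<notin> edges ?G"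
    then show "forbidden m (add_edge {u, v} ?G)"
      using E bspec[OF max, of "insert {u, v} E"] by (auto simp: add_edge_def)
  qed
  then show ?thesis by (intro exI[of _ ?G]) simp
qed

lemma block_eq: "m > 0 \<Longrightarrow> {x. x div m = i} = {i * m..<i * m + m}" for m i :: nat
  by (auto simp: div_nat_eqI algebra_simps div_mult_self3 dividend_less_times_div
      less_mult_imp_div_less)

text \<open>Blocks of \<open>m\<close> consecutive numbers are made into cliques. They are the only
  \<open>m\<close>-cliques and cover every vertex, so a missing edge joins two of them and completes
  a dumbbell. All degrees equal \<open>m - 1\<close>.\<close>

lemma ex_saturated_disjoint_cliques:
  assumes m: "m \<ge> 2"
  shows "\<exists>G. saturated (forbidden_family m) G \<and> card (verts G) = m * t \<and>
    2 * card (edges G) = (m - 1) * (m * t)"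
proof -
  define B where "B i = {x. x div m = i}" for i :: nat
  let ?V = "{..<m * t}"
  let ?G = "(?V, {e \<in> vertex_pairs ?V. \<exists>i. e \<subseteq> B i})"
  have B: "finite (B i)" "card (B i) = m" for i
    using block_eq[of m i] m by (auto simp: B_def)
  have BV: "B (u div m) \<subseteq> ?V" if "u \<in> ?V" for u
  proof
    fix x assume "x \<in> B (u div m)"
    then have "x div m < t" using that m by (simp add: B_def less_mult_imp_div_less mult.commute)
    then show "x \<in> ?V" using m by (simp add: div_less_iff_less_mult mult.commute)
  qed
  have adj: "{u, v} \<in> edges ?G \<longleftrightarrow> u \<in> ?V \<and> v \<in> ?V \<and> u \<noteq> v \<and> u div m = v div m" for u v
    by (auto simp: B_def)
  have G: "?G \<in> fin_graphs" by (auto simp: fin_graphs_def)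
  have block: "K = B (u div m)" if K: "clique m ?G K" "u \<in> K" for K u
  proof -
    have "x div m = u div m" if "x \<in> K" for x
      using cliqueD(3)[OF K(1) that K(2)] adj by (cases "x = u") auto
    then have "K \<subseteq> B (u div m)" by (auto simp: B_def)
    then show ?thesis using B cliqueD(2)[OF K(1)] by (simp add: card_subset_eq)
  qed
  have cliques: "clique m ?G (B (u div m))" if "u \<in> ?V" for u
    using BV[OF that] B vertex_pairs_mono[OF BV[OF that]] by (auto simp: clique_def vertex_pairs_def)
  have "saturated (forbidden_family m) ?G"
    unfolding saturated_iff[OF m]
  proof (intro conjI ballI impI)
    show "\<not> forbidden m ?G" unfolding forbidden_def
    proof (intro notI, elim disjE)
      assume "has_ear m ?G"
      then obtain K x a where "clique m ?G K" "x \<notin> K" "a \<in> K" "{a, x} \<in> edges ?G"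
        unfolding has_ear_def by blast
      then show False using block[of K a] unfolding adj by (simp add: B_def)
    next
      assume "has_bowtie m ?G"
      then obtain K L c where KL: "clique m ?G K" "clique m ?G L" "K \<inter> L = {c}"
        unfolding has_bowtie_def by (auto simp: card_1_singleton_iff)
      then have "K = L" using block[of K c] block[of L c] by blast
      then show False using KL cliqueD(2)[OF KL(1)] m by simp
    next
      assume "has_dumbbell m ?G"
      then obtain K L a b where "clique m ?G K" "clique m ?G L" "K \<inter> L = {}" "a \<in> K" "b \<in> L"
        "{a, b} \<in> edges ?G" unfolding has_dumbbell_def by blast
      then show False using block[of K a] block[of L b] unfolding adj by auto
    qed
    fix u v assume uv: "u \<in> verts ?G" "v \<in> verts ?G" "u \<noteq> v" "{u, v} \<notin> edges ?G"
    then have ne: "u div m \<noteq> v div m" using adj by auto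
    have mono: "clique m (add_edge {u, v} ?G) K" if "clique m ?G K" for K
      using that by (auto simp: clique_def add_edge_def)
    have "clique m (add_edge {u, v} ?G) (B (u div m))" "clique m (add_edge {u, v} ?G) (B (v div m))"
      using uv by (auto intro!: mono cliques)
    moreover have "B (u div m) \<inter> B (v div m) = {}" using ne by (auto simp: B_def)
    moreover have "u \<in> B (u div m)" "v \<in> B (v div m)" by (auto simp: B_def)
    moreover have "{u, v} \<in> edges (add_edge {u, v} ?G)" by (simp add: add_edge_def)
    ultimately show "forbidden m (add_edge {u, v} ?G)"
      unfolding forbidden_def has_dumbbell_def by blast
  qed (rule G)
  moreover have "2 * card (edges ?G) = (m - 1) * (m * t)"
  proof -
    have "card (nbrs ?G v) = m - 1" if "v \<in> ?V" for v
    proof -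
      have "nbrs ?G v = B (v div m) - {v}"
        unfolding nbrs_def adj using that BV[OF that] by (auto simp: B_def)
      then show ?thesis using B by (simp add: B_def)
    qed
    then have "(\<Sum>v\<in>verts ?G. card (nbrs ?G v)) = (m - 1) * (m * t)" by (simp add: mult.commute)
    then show ?thesis using sum_card_nbrs[OF G] by simp
  qed
  ultimately show ?thesis by (intro exI[of _ ?G]) simp
qed

section \<open>Divergence\<close>

text \<open>The infimum of a nonempty set of naturals is its minimum; \<open>ex_saturated\<close>
  supplies nonemptiness.\<close>

lemma sat_attained:
  assumes "m \<ge> 2"
  obtains G where "saturated (forbidden_family m) G" "card (verts G) = n"
    "sat n (forbidden_family m) = card (edges G)"
proof -
  have "sat n (forbidden_family m) \<in>
      {card (edges G) | G. saturated (forbidden_family m) G \<and> card (verts G) = n}"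
    unfolding sat_def using ex_saturated[OF assms, of n] by (intro Inf_nat_def1) blast
  then show thesis using that by blast
qed

lemma sat_le:
  assumes "saturated \<F> G" "card (verts G) = n"
  shows "sat n \<F> \<le> card (edges G)"
  unfolding sat_def using assms by (intro cInf_lower) blast+

text \<open>A limit would be at most \<open>?c\<close> along the multiples of \<open>m\<close>, and
  at least \<open>?c + ?d\<close> along the numbers \<open>m * t + 1\<close>, which \<open>m\<close>
  does not divide.\<close>

lemma not_convergent_sat:
  assumes m: "m \<ge> 4"
  shows "\<not> convergent (\<lambda>n. real (sat n (forbidden_family m)) / real n)"
proof
  let ?s = "\<lambda>n. real (sat n (forbidden_family m)) / real n"
  let ?c = "(real m - 1) / 2" and ?d = "1 / (8 * real m ^ 2)"
  assume "convergent ?s"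
  then obtain l where l: "?s \<longlonglongrightarrow> l" by (auto simp: convergent_def)
  have mono: "strict_mono (\<lambda>t. m * t)" "strict_mono (\<lambda>t. m * t + 1)"
    using m by (auto simp: strict_mono_def)
  have "l \<le> ?c"
  proof (rule LIMSEQ_le_const2)
    show "(\<lambda>t. ?s (m * t)) \<longlonglongrightarrow> l" using LIMSEQ_subseq_LIMSEQ[OF l mono(1)] by (simp add: comp_def)
    have "?s (m * t) \<le> ?c" if "t \<ge> 1" for t
    proof -
      obtain G where "saturated (forbidden_family m) G" "card (verts G) = m * t"
        "2 * card (edges G) = (m - 1) * (m * t)"
        using ex_saturated_disjoint_cliques[of m t] m by auto
      then have "2 * sat (m * t) (forbidden_family m) \<le> (m - 1) * (m * t)"
        using sat_le[of "forbidden_family m" G "m * t"] by simp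
      then have "real (2 * sat (m * t) (forbidden_family m)) \<le> real ((m - 1) * (m * t))"
        by (simp only: of_nat_le_iff)
      then have "2 * real (sat (m * t) (forbidden_family m)) \<le> (real m - 1) * real (m * t)"
        using m by (simp add: of_nat_diff)
      moreover have "real (m * t) > 0" using m that by simp
      ultimately show ?thesis by (simp add: field_simps del: of_nat_mult)
    qed
    then show "\<exists>N. \<forall>t\<ge>N. ?s (m * t) \<le> ?c" by blast
  qed
  moreover have "?c + ?d \<le> l"
  proof (rule LIMSEQ_le)
    show "(\<lambda>t. ?s (m * t + 1)) \<longlonglongrightarrow> l" using LIMSEQ_subseq_LIMSEQ[OF l mono(2)] by (simp add: comp_def)
    \<comment> \<open>Divided by \<open>n\<close>, the additive loss \<open>m\<close> of
      \<open>edges_lower_bound\<close> becomes an error term that tends to zero.\<close>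
    have "(\<lambda>n. ?c + ?d - real m * (1 / real n)) \<longlonglongrightarrow> ?c + ?d - real m * 0"
      by (intro tendsto_intros lim_1_over_n)
    from LIMSEQ_subseq_LIMSEQ[OF this mono(2)]
    show "(\<lambda>t. ?c + ?d - real m * (1 / real (m * t + 1))) \<longlonglongrightarrow> ?c + ?d" by (simp add: comp_def)
    have "?c + ?d - real m * (1 / real (m * t + 1)) \<le> ?s (m * t + 1)" if "t \<ge> 4 * m ^ 3" for t
    proof -
      let ?n = "m * t + 1"
      obtain G where G: "saturated (forbidden_family m) G" "card (verts G) = ?n"
        "sat ?n (forbidden_family m) = card (edges G)"
        using sat_attained[of m ?n] m by auto
      have "\<not> m dvd ?n" using m by (subst dvd_add_right_iff) auto
      moreover have "t \<le> m * t" using m by simp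
      then have "4 * m ^ 3 \<le> ?n" using that by linarith
      ultimately have "(?c + ?d) * real ?n - real m \<le> real (sat ?n (forbidden_family m))"
        using edges_lower_bound[OF m G(1,2)] G(3) by simp
      then have "((?c + ?d) * real ?n - real m) / real ?n \<le> ?s ?n"
        by (intro divide_right_mono) auto
      then show ?thesis by (simp add: diff_divide_distrib del: of_nat_add of_nat_mult)
    qed
    then show "\<exists>N. \<forall>t\<ge>N. ?c + ?d - real m * (1 / real (m * t + 1)) \<le> ?s (m * t + 1)" by blast
  qed
  moreover have "?d > 0" using m by simp
  ultimately show False by linarith
qed

theorem theorem1p8:
  "infinite {\<F>. \<F> \<subseteq> iso_classes \<and> card \<F> = 3 \<and>
     \<not> convergent (\<lambda>n. real (sat n \<F>) / real n)}"
proof (rule infinite_super)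
  show "forbidden_family ` {4..} \<subseteq> {\<F>. \<F> \<subseteq> iso_classes \<and> card \<F> = 3 \<and>
     \<not> convergent (\<lambda>n. real (sat n \<F>) / real n)}"
  proof (intro image_subsetI CollectI conjI)
    fix m :: nat assume "m \<in> {4..}"
    then show "forbidden_family m \<subseteq> iso_classes" "card (forbidden_family m) = 3"
      "\<not> convergent (\<lambda>n. real (sat n (forbidden_family m)) / real n)"
      by (simp_all add: forbidden_family_subset card_forbidden_family not_convergent_sat)
  qed
  have "inj_on forbidden_family {4..}"
    using inj_on_forbidden_family by (rule inj_on_subset) auto
  then show "infinite (forbidden_family ` {4..})"
    by (simp add: finite_image_iff infinite_Ici)
qed

end
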